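(* Fix an integer $j \geq 2$ and a real number $0 < c \leq 1$. Then $\lambda_{s}(n, j) = \Theta(s n^2)$ for $s \geq c n$, where the constant in the bound depends on $c$ and $j$.
   Context: All sequences are finite. A sequence is $j$-sparse if every contiguous subsequence of length $j$ has all letters distinct. A Davenport-Schinzel sequence of order $s$ is a sequence with no adjacent same letters that avoids alternations of length $s+2$, i.e. that has no (not necessarily contiguous) subsequence of the form $a\,b\,a\,b\dots$ of length $s+2$ with $a \neq b$. A $DS(n,s)$-sequence is a Davenport-Schinzel sequence of order $s$ with $n$ distinct letters. $\lambda_s(n,j)$ denotes the maximum possible length of a $j$-sparse $DS(n,s)$-sequence. The parameters $n$ and $s$ are positive integers. The asymptotic statement is as $n \to \infty$, uniformly over all integers $s \geq cn$: $\Theta(s n^2)$ means bounded above and below by positive constants (depending only on $c$ and $j$) times $s n^2$, for all sufficiently large $n$ and all such $s$. *)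

theory Defs
  imports Complex_Main "HOL-Library.Sublist"
begin

definition sparse :: "nat \<Rightarrow> 'a list \<Rightarrow> bool" where
  "sparse j xs \<longleftrightarrow> (\<forall>ys. sublist ys xs \<and> length ys = j \<longrightarrow> distinct ys)"

text \<open>The word \<open>a b a b \<dots>\<close> of length \<open>k\<close>.\<close>

definition alternation :: "'a \<Rightarrow> 'a \<Rightarrow> nat \<Rightarrow> 'a list" where
  "alternation a b k = map (\<lambda>i. if even i then a else b) [0..<k]"

definition davenport_schinzel :: "nat \<Rightarrow> 'a list \<Rightarrow> bool" where
  "davenport_schinzel s xs \<longleftrightarrow>
     distinct_adj xs \<and> (\<forall>a b. a \<noteq> b \<longrightarrow> \<not> subseq (alternation a b (s + 2)) xs)"

definition DS_sequence :: "nat \<Rightarrow> nat \<Rightarrow> 'a list \<Rightarrow> bool" where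
  "DS_sequence n s xs \<longleftrightarrow> davenport_schinzel s xs \<and> card (set xs) = n"

text \<open>
  All notions above are invariant under injective relabelling of letters, so sequences over the
  alphabet \<^typ>\<open>nat\<close> suffice. For \<open>s \<ge> 1\<close> the set of lengths below is nonempty (it contains \<open>n\<close>,
  via a sequence of \<open>n\<close> distinct letters) and finite (each two-letter alternation is bounded),
  so \<^const>\<open>Max\<close> is the genuine maximum.
\<close>

definition DS_lambda :: "nat \<Rightarrow> nat \<Rightarrow> nat \<Rightarrow> nat" where
  "DS_lambda s n j = Max {length xs |xs :: nat list. DS_sequence n s xs \<and> sparse j xs}"

end

theory Submission
  imports Defs
begin

text \<open>
  The upper bound is double counting. If the ordered
  pair \<open>a b\<close> occurs \<open>h\<close> times in adjacent positions, these occurrences are disjoint and concatenate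
  to an alternation of length \<open>2 * h\<close> (\<open>subseq_alternation_count_adjacent\<close>). Hence \<open>h \<le> s\<close>, and since
  each of the \<open>length xs - 1\<close> adjacencies belongs to one of at most \<open>n\<^sup>2\<close> ordered pairs, the length
  is at most \<open>1 + s * n\<^sup>2\<close>.

  For the lower bound, the alternations are spent on few pairs at a time. Letters are points
  \<open>(i, v)\<close> with \<open>i < k\<close>, and a block is a line \<open>v = x + i * y\<close> with \<open>x, y < m\<close>. Two points lie on at
  most one common line, and a point lies on at most \<open>m\<close> lines. Write each of the \<open>m\<^sup>2\<close> lines \<open>t\<close> times
  in a row and concatenate. For two letters \<open>a\<close> and \<open>b\<close>, the line through both contributes at most
  \<open>2 * t\<close> runs, and every line through just one of them contributes at most one run, so no
  alternation of \<open>a\<close> and \<open>b\<close> is longer than \<open>2 * m + 2 * t\<close> (\<open>runs_line_word_le\<close>).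
  Because every line lists its points by increasing \<open>i\<close>, the coordinate \<open>i\<close> runs periodically
  through \<open>0, \<dots>, k - 1\<close> along the whole sequence, so any \<open>k\<close> consecutive letters are distinct, even
  across the boundaries of blocks.

  The construction has length \<open>m\<^sup>2 * t * k\<close> and needs about \<open>k\<^sup>2 * m\<close> letters. With \<open>n\<close> letters, \<open>m\<close> is
  about \<open>n / k\<^sup>2\<close>; taking \<open>k\<close> a constant that is at least \<open>j\<close> and \<open>8 / c\<close> makes the cost \<open>2 * m\<close> at most
  \<open>s / 4\<close>, which leaves room for \<open>t\<close> of order \<open>s\<close>. The length is then of order \<open>s * n\<^sup>2\<close>.
\<close>

section \<open>Alternations\<close>

lemma alternation_Suc_Suc: "alternation a b (Suc (Suc k)) = a # b # alternation a b k"
proof (rule nth_equalityI)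
  fix i assume "i < length (alternation a b (Suc (Suc k)))"
  then show "alternation a b (Suc (Suc k)) ! i = (a # b # alternation a b k) ! i"
    by (cases i rule: nat.exhaust; cases "i - 1")
      (auto simp: alternation_def nth_Cons' simp del: upt_Suc)
qed (simp add: alternation_def)

lemma alternation_0 [simp]: "alternation a b 0 = []"
  by (simp add: alternation_def)

lemma length_alternation [simp]: "length (alternation a b k) = k"
  by (simp add: alternation_def)

lemma set_alternation: "set (alternation a b k) \<subseteq> {a, b}"
  by (auto simp: alternation_def)

lemma distinct_adj_alternation: "a \<noteq> b \<Longrightarrow> distinct_adj (alternation a b k)"
  by (auto simp: distinct_adj_conv_nth alternation_def simp del: upt_Suc)

lemma prefix_alternation: "k \<le> l \<Longrightarrow> prefix (alternation a b k) (alternation a b l)"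
  using upt_add_eq_append[of 0 k "l - k"] by (simp add: alternation_def)

section \<open>Adjacent pairs and the upper bound\<close>

text \<open>
  Occurrences of \<open>a b\<close> cannot overlap because \<open>a \<noteq> b\<close>, so they line up to an alternation.
\<close>

lemma subseq_alternation_count_adjacent:
  assumes "a \<noteq> b"
  shows "subseq (alternation a b (2 * count_list (zip xs (tl xs)) (a, b))) xs"
proof (induction xs)
  case (Cons x xs)
  show ?case
  proof (cases "\<exists>ys. x = a \<and> xs = b # ys")
    case True
    then obtain ys where [simp]: "x = a" "xs = b # ys" by auto
    define h where "h = count_list (zip (b # ys) ys) (a, b)"
    have IH: "subseq (alternation a b (2 * h)) (b # ys)"
      using Cons.IH by (simp add: h_def)
    (* A nonempty alternation starts with a, so it cannot use the letter b in front of ys. *)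
    have "subseq (alternation a b (2 * h)) ys"
    proof (cases h)
      case (Suc h')
      then show ?thesis
        using IH assms by (auto simp: alternation_Suc_Suc)
    qed simp
    moreover have "count_list (zip (x # xs) (tl (x # xs))) (a, b) = Suc h"
      by (simp add: h_def)
    ultimately show ?thesis
      by (simp add: alternation_Suc_Suc)
  next
    case False
    then have "count_list (zip (x # xs) (tl (x # xs))) (a, b)
        = count_list (zip xs (tl xs)) (a, b)"
      by (cases xs) auto
    then show ?thesis
      using Cons.IH by auto
  qed
qed simp

lemma length_davenport_schinzel_le:
  assumes "davenport_schinzel s xs"
  shows "length xs \<le> 1 + s * (card (set xs))\<^sup>2"
proof -
  let ?z = "zip xs (tl xs)"
  have count: "count_list ?z p \<le> s" for p
  proof (cases p)
    case [simp]: (Pair a b)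
    show ?thesis
    proof (cases "a = b")
      case True
      have "(a, a) \<notin> set ?z"
        using assms by (auto simp: davenport_schinzel_def distinct_adj_conv_nth in_set_zip nth_tl)
      then show ?thesis using True by (simp add: count_notin)
    next
      case False
      have "\<not> subseq (alternation a b (s + 2)) xs"
        using assms False by (auto simp: davenport_schinzel_def)
      moreover have "subseq (alternation a b (2 * count_list ?z p)) xs"
        using subseq_alternation_count_adjacent[OF False] by simp
      ultimately have "\<not> s + 2 \<le> 2 * count_list ?z p"
        using prefix_alternation prefix_imp_subseq subseq_order.trans by metis
      then show ?thesis by linarith
    qed
  qed
  have "set ?z \<subseteq> set xs \<times> set xs"
    by (auto dest: set_zip_leftD set_zip_rightD list.set_sel(2)[rotated])
       (metis list.sel(2) list.set_sel(2) set_zip_rightD)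
  then have "length ?z = (\<Sum>p\<in>set xs \<times> set xs. count_list ?z p)"
    by (simp add: sum_count_set)
  also have "\<dots> \<le> (\<Sum>p\<in>set xs \<times> set xs. s)"
    by (intro sum_mono count)
  also have "\<dots> = s * (card (set xs))\<^sup>2"
    by (simp add: card_cartesian_product power2_eq_square)
  finally show ?thesis by simp
qed

section \<open>Counting runs\<close>

text \<open>
  A list without adjacent repetitions can use each run of equal letters only once, so contracting
  the runs yields the longest such subsequence. This turns the search for alternations into the
  counting of runs.
\<close>

lemma length_subseq_le_remdups_adj:
  assumes "subseq zs xs" "distinct_adj zs"
  shows "length zs \<le> length (remdups_adj xs)"
  using assms
proof (induction xs arbitrary: zs rule: remdups_adj.induct)
  case (3 x y xs)
  show ?case
  proof (cases "\<exists>ws. zs = x # ws")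
    case False
    then have "subseq zs (y # xs)"
      using "3.prems"(1) by (cases zs) (auto simp: subseq_Cons2_neq split: if_splits)
    then have "length zs \<le> length (remdups_adj (y # xs))"
      using "3.IH" "3.prems"(2) by (cases "x = y") auto
    then show ?thesis by auto
  next
    case True
    then obtain ws where zs: "zs = x # ws" by auto
    then have ws: "subseq ws (y # xs)" "distinct_adj ws" "ws \<noteq> [] \<Longrightarrow> hd ws \<noteq> x"
      using "3.prems" by (auto simp: distinct_adj_Cons)
    show ?thesis
    proof (cases "x = y")
      case True
      then have "subseq zs (y # xs)"
        using zs ws by (cases ws) auto
      then show ?thesis using True "3.IH"(1) "3.prems"(2) by simp
    next
      case False
      then show ?thesis using "3.IH"(2)[OF False ws(1,2)] zs by simp
    qed
  qed
next
  case (2 x)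
  then show ?case by (cases zs) (auto split: if_splits)
qed simp

text \<open>
  The number of maximal constant runs left after all letters other than \<open>a\<close> and \<open>b\<close> are erased.
\<close>

definition runs :: "'a \<Rightarrow> 'a \<Rightarrow> 'a list \<Rightarrow> nat" where
  "runs a b xs = length (remdups_adj (filter (\<lambda>x. x = a \<or> x = b) xs))"

lemma alternation_le_runs:
  assumes "a \<noteq> b" "subseq (alternation a b k) xs"
  shows "k \<le> runs a b xs"
proof -
  have "filter (\<lambda>x. x = a \<or> x = b) (alternation a b k) = alternation a b k"
    using set_alternation[of a b k] by (auto simp: filter_id_conv)
  then have "subseq (alternation a b k) (filter (\<lambda>x. x = a \<or> x = b) xs)"
    using subseq_filter[OF assms(2)] by metis
  then show ?thesis
    unfolding runs_def
    using length_subseq_le_remdups_adj distinct_adj_alternation[OF assms(1)] by fastforce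
qed

lemma subseq_remdups_adj: "subseq (remdups_adj xs) xs"
proof (induction xs rule: remdups_adj.induct)
  case (3 x y xs)
  then show ?case by (cases "x = y") auto
qed auto

lemma runs_append: "runs a b (xs @ ys) \<le> runs a b xs + runs a b ys"
proof -
  let ?f = "filter (\<lambda>x. x = a \<or> x = b)"
  have "subseq (remdups_adj (?f xs @ ?f ys)) (?f xs @ ?f ys)"
    by (rule subseq_remdups_adj)
  then obtain us vs where uv: "remdups_adj (?f xs @ ?f ys) = us @ vs"
      "subseq us (?f xs)" "subseq vs (?f ys)"
    by (auto elim: subseq_appendE)
  moreover have "distinct_adj us" "distinct_adj vs"
    using distinct_adj_remdups_adj[of "?f xs @ ?f ys"] uv(1)
    by (auto simp: distinct_adj_append_iff)
  ultimately show ?thesis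
    using length_subseq_le_remdups_adj[of us "?f xs"] length_subseq_le_remdups_adj[of vs "?f ys"]
    by (simp add: runs_def)
qed

lemma runs_concat: "runs a b (concat xss) \<le> (\<Sum>xs\<leftarrow>xss. runs a b xs)"
proof (induction xss)
  case (Cons xs xss)
  then show ?case using runs_append[of a b xs "concat xss"] by simp
qed (simp add: runs_def)

lemma runs_le_length_filter: "runs a b xs \<le> length (filter (\<lambda>x. x = a \<or> x = b) xs)"
  by (simp add: runs_def)

lemma runs_distinct_le: "distinct xs \<Longrightarrow> runs a b xs \<le> 2"
proof -
  assume "distinct xs"
  then have "length (filter (\<lambda>x. x = a \<or> x = b) xs)
      = card (set (filter (\<lambda>x. x = a \<or> x = b) xs))"
    by (simp only: distinct_card distinct_filter)
  also have "\<dots> \<le> card {a, b}" by (intro card_mono) auto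
  also have "\<dots> \<le> 2" by (simp add: card_insert_if)
  finally show ?thesis using runs_le_length_filter[of a b xs] by simp
qed

lemma distinct_adj_subset_singleton:
  assumes "distinct_adj ys" "set ys \<subseteq> {a}"
  shows "length ys \<le> 1"
  using assms by (cases ys; cases "tl ys") (auto simp: distinct_adj_Cons)

text \<open>
  If only one of \<open>a\<close> and \<open>b\<close> occurs in \<open>w\<close>, repeating \<open>w\<close> produces a single run however large \<open>t\<close> is;
  only a word containing both letters pays for the repetition. The bound is written with indicators
  so that it can be summed over all lines.
\<close>

lemma runs_replicate_le:
  assumes "distinct w"
  shows "runs a b (concat (replicate t w)) \<le>
    of_bool (a \<in> set w) + of_bool (b \<in> set w) + 2 * t * of_bool (a \<in> set w \<and> b \<in> set w)"
proof -
  let ?W = "concat (replicate t w)"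
  let ?f = "filter (\<lambda>x. x = a \<or> x = b) ?W"
  have W: "set ?f \<subseteq> {a, b} \<inter> set w" by auto
  consider "a \<in> set w" "b \<in> set w" | "a \<notin> set w" "b \<notin> set w"
    | "a \<in> set w" "b \<notin> set w" | "a \<notin> set w" "b \<in> set w" by blast
  then show ?thesis
  proof cases
    case 1
    have "runs a b ?W \<le> (\<Sum>xs\<leftarrow>replicate t w. runs a b xs)" by (rule runs_concat)
    also have "\<dots> \<le> 2 * t"
      using runs_distinct_le[OF assms, of a b] by (simp add: sum_list_replicate)
    finally show ?thesis using 1 by simp
  next
    case 2
    then have "?f = []" using W by (simp add: filter_empty_conv) blast
    then show ?thesis using 2 by (simp add: runs_def)
  next
    case 3
    then have "set ?f \<subseteq> {a}" using W by blast
    then have "runs a b ?W \<le> 1" unfolding runs_def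
      by (intro distinct_adj_subset_singleton[of _ a]) auto
    then show ?thesis using 3 by simp
  next
    case 4
    then have "set ?f \<subseteq> {b}" using W by blast
    then have "runs a b ?W \<le> 1" unfolding runs_def
      by (intro distinct_adj_subset_singleton[of _ b]) auto
    then show ?thesis using 4 by simp
  qed
qed

section \<open>Points and lines\<close>

text \<open>
  The number \<open>v * k + i\<close> encodes the point \<open>(i, v)\<close>, so its coordinates are recovered by \<open>mod\<close> and
  \<open>div\<close>. The pair \<open>(x, y)\<close> stands for the line with intercept \<open>x\<close> and slope \<open>y\<close>. The values \<open>x + i * y\<close>
  are taken in the natural numbers and not modulo \<open>m\<close>: this costs a factor \<open>k\<close> in the number of
  letters, but two distinct lines then share at most one point for every \<open>m\<close>, prime or not.
\<close>

definition line :: "nat \<Rightarrow> nat \<times> nat \<Rightarrow> nat list" where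
  "line k = (\<lambda>(x, y). map (\<lambda>i. (x + i * y) * k + i) [0..<k])"

lemma length_line [simp]: "length (line k p) = k"
  by (simp add: line_def split: prod.split)

lemma map_mod_line: "map (\<lambda>v. v mod k) (line k p) = [0..<k]"
  by (cases p) (auto simp: line_def intro!: nth_equalityI)

lemma distinct_line: "distinct (line k p)"
  by (metis map_mod_line distinct_upt distinct_map)

lemma mem_line_iff:
  "k > 0 \<Longrightarrow> v \<in> set (line k (x, y)) \<longleftrightarrow> v div k = x + (v mod k) * y"
proof
  assume "k > 0" and eq: "v div k = x + (v mod k) * y"
  have "v = v div k * k + v mod k" by simp
  then have "v = (x + (v mod k) * y) * k + v mod k" using eq by metis
  then show "v \<in> set (line k (x, y))"
    using \<open>k > 0\<close> unfolding line_def
    by (auto intro!: image_eqI[of _ _ "v mod k"] simp del: mod_mult_self1 mod_mult_self3)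
qed (auto simp: line_def)

lemma set_line_subset:
  assumes "x < m" "y < m"
  shows "set (line k (x, y)) \<subseteq> {..<k\<^sup>2 * m}"
proof
  fix v assume "v \<in> set (line k (x, y))"
  then obtain i where i: "i < k" "v = (x + i * y) * k + i" by (auto simp: line_def)
  have "i * y \<le> (k - 1) * m"
    using i(1) assms(2) by (intro mult_mono) auto
  moreover have "(k - 1) * m + m = k * m"
    using i(1) by (cases k) auto
  ultimately have "Suc (x + i * y) \<le> k * m" using assms(1) by linarith
  then have "Suc (x + i * y) * k \<le> k * m * k" by (intro mult_right_mono) auto
  then show "v \<in> {..<k\<^sup>2 * m}"
    using i by (simp add: power2_eq_square algebra_simps)
qed

text \<open>
  A point and a slope determine the intercept.
\<close>

lemma card_lines_through_le:
  assumes "k > 0"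
  shows "card {p \<in> {..<m} \<times> {..<m}. a \<in> set (line k p)} \<le> m"
proof -
  have "inj_on snd {p \<in> {..<m} \<times> {..<m}. a \<in> set (line k p)}"
    by (rule inj_onI) (auto simp: mem_line_iff[OF assms])
  then have "card {p \<in> {..<m} \<times> {..<m}. a \<in> set (line k p)} \<le> card {..<m}"
    by (rule card_inj_on_le) auto
  then show ?thesis by simp
qed

text \<open>
  Distinct points of a line have different first coordinates, so they determine the slope, and then
  the intercept.
\<close>

lemma line_determined:
  assumes "k > 0" "a \<noteq> b"
    and "a \<in> set (line k p)" "b \<in> set (line k p)" "a \<in> set (line k q)" "b \<in> set (line k q)"
  shows "p = q"
proof -
  obtain x y x' y' where [simp]: "p = (x, y)" "q = (x', y')" by fastforce
  (* Integers, because the slopes and the intercepts are compared by subtraction. *)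
  define i j where ij: "i = int (a mod k)" "j = int (b mod k)"
  have E: "int (a div k) = int x + i * int y" "int (b div k) = int x + j * int y"
    "int (a div k) = int x' + i * int y'" "int (b div k) = int x' + j * int y'"
    using assms(3-) mem_line_iff[OF assms(1)] unfolding ij
    by (metis \<open>p = (x, y)\<close> \<open>q = (x', y')\<close> of_nat_add of_nat_mult)+
  have "i \<noteq> j"
  proof
    assume "i = j"
    then have "a mod k = b mod k" "a div k = b div k" using E ij by auto
    then show False using assms(2) by (metis div_mult_mod_eq)
  qed
  have "(i - j) * (int y - int y') = 0" using E by (simp add: algebra_simps)
  then have "y = y'" using \<open>i \<noteq> j\<close> by simp
  then show ?thesis using E by simp
qed

lemma card_lines_through_pair_le:
  assumes "k > 0" "a \<noteq> b"
  shows "card {p \<in> {..<m} \<times> {..<m}. a \<in> set (line k p) \<and> b \<in> set (line k p)} \<le> 1"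
  using line_determined[OF assms] by (subst One_nat_def, subst card_le_Suc0_iff_eq) auto

section \<open>The concatenation of repeated lines\<close>

definition line_word :: "nat \<Rightarrow> nat \<Rightarrow> nat \<Rightarrow> nat list" where
  "line_word k m t =
     concat (map (\<lambda>p. concat (replicate t (line k p))) (List.product [0..<m] [0..<m]))"

text \<open>
  Summing the bound for a single line, each letter accounts for at most \<open>m\<close> runs by its incidences,
  and the factor \<open>2 * t\<close> occurs at most once, for the line through both letters.
\<close>

lemma runs_line_word_le:
  assumes "k > 0" "a \<noteq> b"
  shows "runs a b (line_word k m t) \<le> 2 * m + 2 * t"
proof -
  let ?P = "{..<m} \<times> {..<m}"
  let ?r = "\<lambda>p. runs a b (concat (replicate t (line k p)))"
  let ?A = "\<lambda>p. a \<in> set (line k p)" and ?B = "\<lambda>p. b \<in> set (line k p)"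
  have "runs a b (line_word k m t) \<le> (\<Sum>p\<leftarrow>List.product [0..<m] [0..<m]. ?r p)"
    unfolding line_word_def by (rule order_trans[OF runs_concat]) (simp add: o_def)
  also have "\<dots> = (\<Sum>p\<in>?P. ?r p)"
    by (subst sum_list_distinct_conv_sum_set) (auto simp: distinct_product atLeast0LessThan)
  also have "\<dots> \<le> (\<Sum>p\<in>?P. of_bool (?A p) + of_bool (?B p) + 2 * t * of_bool (?A p \<and> ?B p))"
    by (intro sum_mono runs_replicate_le distinct_line)
  also have "\<dots> = card {p \<in> ?P. ?A p} + card {p \<in> ?P. ?B p} + 2 * t * card {p \<in> ?P. ?A p \<and> ?B p}"
    by (simp add: sum.distrib flip: sum_distrib_left) (simp add: Int_def conj_ac)
  also have "\<dots> \<le> m + m + 2 * t * 1"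
    using assms by (intro add_mono mult_left_mono card_lines_through_le card_lines_through_pair_le) auto
  finally show ?thesis by simp
qed

lemma concat_replicate_upt: "concat (replicate N [0..<k]) = map (\<lambda>p. p mod k) [0..<N * k]"
proof (induction N)
  case (Suc N)
  have "concat (replicate (Suc N) [0..<k]) = concat (replicate N [0..<k]) @ [0..<k]"
    by (metis replicate_Suc replicate_append_same concat_append concat.simps append_Nil2)
  also have "\<dots> = map (\<lambda>p. p mod k) ([0..<N * k] @ [N * k..<N * k + k])"
    using Suc.IH by (auto intro!: nth_equalityI simp: nth_append)
  also have "[0..<N * k] @ [N * k..<N * k + k] = [0..<Suc N * k]"
    by (metis add.commute mult_Suc upt_add_eq_append zero_le)
  finally show ?case .
qed simp

text \<open>
  Every line visits the residues \<open>0, \<dots>, k - 1\<close> in this order, so the residues of the whole word are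
  periodic. This yields both its length and its sparsity.
\<close>

lemma map_mod_line_word:
  "map (\<lambda>v. v mod k) (line_word k m t) = map (\<lambda>p. p mod k) [0..<m\<^sup>2 * t * k]"
proof -
  have "concat (replicate r (concat (replicate t w))) = concat (replicate (r * t) w)" for r and w :: "nat list"
    by (induction r) (auto simp: replicate_add)
  moreover have "map (\<lambda>v. v mod k) (line_word k m t) =
      concat (replicate (m\<^sup>2) (concat (replicate t [0..<k])))"
    by (simp add: line_word_def map_concat o_def map_mod_line map_replicate_const length_product
        power2_eq_square)
  ultimately show ?thesis by (metis concat_replicate_upt)
qed

lemma length_line_word: "length (line_word k m t) = m\<^sup>2 * t * k"
  using arg_cong[OF map_mod_line_word[of k m t], of length] by simp

lemma nth_line_word_mod: "p < m\<^sup>2 * t * k \<Longrightarrow> line_word k m t ! p mod k = p mod k"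
  using arg_cong[OF map_mod_line_word[of k m t], of "\<lambda>xs. xs ! p"]
  by (simp add: length_line_word)

lemma set_line_word: "set (line_word k m t) \<subseteq> {..<k\<^sup>2 * m}"
  using set_line_subset by (fastforce simp: line_word_def)

lemma sparseI:
  assumes "\<And>p q. p < q \<Longrightarrow> q < p + j \<Longrightarrow> q < length xs \<Longrightarrow> xs ! p \<noteq> xs ! q"
  shows "sparse j xs"
  unfolding sparse_def
proof (intro allI impI, elim conjE)
  fix ys assume "sublist ys xs" and len: "length ys = j"
  then obtain ps ss where xs: "xs = ps @ ys @ ss" by (auto simp: sublist_def)
  have "ys ! p \<noteq> ys ! q" if "p < q" "q < length ys" for p q
    using assms[of "length ps + p" "length ps + q"] that len by (simp add: xs nth_append)
  then show "distinct ys"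
    by (auto simp: distinct_conv_nth) (metis nat_neq_iff)
qed

lemma mod_neq_of_close:
  fixes p q k :: nat
  assumes "p < q" "q < p + k"
  shows "p mod k \<noteq> q mod k"
proof
  assume "p mod k = q mod k"
  then have "k dvd q - p" using assms(1) by (metis mod_eq_dvd_iff_nat less_imp_le)
  then show False using assms by (auto dest: dvd_imp_le)
qed

text \<open>
  Appending each missing letter once makes the number of letters exactly \<open>n\<close> at the cost of at most
  two more runs for any pair of letters.
\<close>

definition padded_line_word :: "nat \<Rightarrow> nat \<Rightarrow> nat \<Rightarrow> nat \<Rightarrow> nat list" where
  "padded_line_word k m t n =
     line_word k m t @ filter (\<lambda>v. v \<notin> set (line_word k m t)) [0..<n]"

lemma padded_line_word_nth_neq:
  assumes "p < q" "q < p + k" "q < length (padded_line_word k m t n)"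
  shows "padded_line_word k m t n ! p \<noteq> padded_line_word k m t n ! q"
proof -
  let ?L = "line_word k m t" and ?F = "filter (\<lambda>v. v \<notin> set (line_word k m t)) [0..<n]"
  have w: "padded_line_word k m t n = ?L @ ?F" by (simp add: padded_line_word_def)
  consider "q < length ?L" | "p < length ?L" "length ?L \<le> q" | "length ?L \<le> p" by linarith
  then show ?thesis
  proof cases
    case 1
    then have "?L ! p mod k \<noteq> ?L ! q mod k"
      using assms mod_neq_of_close by (simp add: nth_line_word_mod length_line_word)
    then show ?thesis using 1 assms by (auto simp: w nth_append)
  next
    case 2
    then have "?F ! (q - length ?L) \<in> set ?F"
      using assms by (intro nth_mem) (simp add: w)
    moreover have "?L ! p \<in> set ?L" using 2 by simp
    ultimately have "?L ! p \<noteq> ?F ! (q - length ?L)" by auto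
    then show ?thesis using 2 by (simp add: w nth_append)
  next
    case 3
    have "distinct ?F" by simp
    then have "?F ! (p - length ?L) \<noteq> ?F ! (q - length ?L)"
      using 3 assms by (subst nth_eq_iff_index_eq) (auto simp: w)
    then show ?thesis using 3 assms by (simp add: w nth_append)
  qed
qed

lemma padded_line_word_DS:
  assumes "2 \<le> k" "k\<^sup>2 * m \<le> n" "2 * m + 2 * t + 1 \<le> s"
  shows "DS_sequence n s (padded_line_word k m t n)"
proof -
  let ?w = "padded_line_word k m t n"
  have "distinct_adj ?w"
    unfolding distinct_adj_conv_nth using padded_line_word_nth_neq assms(1) by simp
  moreover have "\<not> subseq (alternation a b (s + 2)) ?w" if "a \<noteq> b" for a b
  proof
    assume "subseq (alternation a b (s + 2)) ?w"
    then have "s + 2 \<le> runs a b ?w" by (rule alternation_le_runs[OF that])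
    also have "\<dots> \<le> runs a b (line_word k m t) + 2"
      unfolding padded_line_word_def
      by (rule order_trans[OF runs_append]) (simp add: runs_distinct_le)
    also have "\<dots> \<le> 2 * m + 2 * t + 2"
      using runs_line_word_le[of k a b m t] assms(1) that by simp
    finally show False using assms(3) by simp
  qed
  moreover have "set ?w = {..<n}"
    using set_line_word[of k m t] assms(2) by (fastforce simp: padded_line_word_def)
  ultimately show ?thesis by (simp add: DS_sequence_def davenport_schinzel_def)
qed

lemma sparse_padded_line_word: "j \<le> k \<Longrightarrow> sparse j (padded_line_word k m t n)"
  by (intro sparseI padded_line_word_nth_neq) auto

section \<open>Asymptotics\<close>

text \<open>
  A single sequence serves twice: its length bounds the maximum from below, and its existence shows
  that the maximum is taken over a nonempty set, without which the upper bound would not carry over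
  to \<^const>\<open>DS_lambda\<close>.
\<close>

lemma DS_lambda_bounds:
  assumes "DS_sequence n s xs" "sparse j (xs :: nat list)"
  shows "length xs \<le> DS_lambda s n j" "DS_lambda s n j \<le> 1 + s * n\<^sup>2"
proof -
  let ?S = "{length xs |xs :: nat list. DS_sequence n s xs \<and> sparse j xs}"
  have bound: "l \<le> 1 + s * n\<^sup>2" if "l \<in> ?S" for l
    using that length_davenport_schinzel_le by (fastforce simp: DS_sequence_def)
  then have fin: "finite ?S" by (meson finite_nat_set_iff_bounded_le)
  show "length xs \<le> DS_lambda s n j"
    unfolding DS_lambda_def using assms by (intro Max_ge fin) auto
  have "?S \<noteq> {}" using assms by auto
  then show "DS_lambda s n j \<le> 1 + s * n\<^sup>2"
    unfolding DS_lambda_def using fin bound by (subst Max_le_iff) auto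
qed

theorem theorem2p5:
  fixes j :: nat and c :: real
  assumes "j \<ge> 2" and "0 < c" and "c \<le> 1"
  shows "\<exists>A>0. \<exists>B>0. \<forall>\<^sub>F n in sequentially. \<forall>s::nat. s \<ge> 1 \<and> real s \<ge> c * real n \<longrightarrow>
           A * (real s * (real n)\<^sup>2) \<le> real (DS_lambda s n j) \<and>
           real (DS_lambda s n j) \<le> B * (real s * (real n)\<^sup>2)"
proof -
  (* k is at least j for sparsity, and at least 8 / c to make 8 * m at most c * n, hence at most s. *)
  define k where "k = max j (nat \<lceil>8 / c\<rceil>)"
  have kj: "j \<le> k" "2 \<le> k" using assms(1) by (auto simp: k_def)
  have kc: "8 \<le> c * real k"
  proof -
    have "8 / c \<le> real k" unfolding k_def by linarith
    then show ?thesis using assms(2) by (simp add: field_simps)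
  qed
  (* The length m^2 * t * k with m at least n / (2 * k^2) and t at least s / 8. *)
  define A where "A = 1 / (32 * real k ^ 3)"
  have "A > 0" using kj by (simp add: A_def)
  (* From N on, m is at least 1 and s is at least 4, so rounding down loses at most a factor 2. *)
  define N where "N = max (k\<^sup>2) (nat \<lceil>4 / c\<rceil>)"
  have main: "A * (real s * (real n)\<^sup>2) \<le> real (DS_lambda s n j) \<and>
           real (DS_lambda s n j) \<le> 2 * (real s * (real n)\<^sup>2)"
    if n: "N \<le> n" and s: "s \<ge> 1" "real s \<ge> c * real n" for n s :: nat
  proof -
    define m t where "m = n div k\<^sup>2" and "t = s div 4"
    have nk: "k\<^sup>2 \<le> n" using n by (simp add: N_def)
    then have npos: "n > 0" using kj by (cases n) auto
    have s4: "4 \<le> s"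
    proof -
      have "4 / c \<le> real n" using n unfolding N_def by linarith
      then have "4 \<le> c * real n" using assms(2) by (simp add: field_simps)
      then show ?thesis using s(2) by linarith
    qed
    have km: "k\<^sup>2 * m \<le> n" by (simp add: m_def)
    have m8: "8 * m \<le> s"
    proof -
      have "8 * real m \<le> c * real k * real m" using kc by (intro mult_right_mono) auto
      also have "\<dots> \<le> c * (real k)\<^sup>2 * real m"
        using kj assms(2) by (intro mult_right_mono mult_left_mono) (auto simp: power2_eq_square)
      also have "\<dots> \<le> c * real n"
        using km assms(2) by (simp add: mult.assoc flip: of_nat_power of_nat_mult)
      finally show ?thesis using s(2) by linarith
    qed
    have "2 * m + 2 * t + 1 \<le> s" using m8 s4 unfolding t_def by linarith
    then have DS: "DS_sequence n s (padded_line_word k m t n)"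
      using padded_line_word_DS kj km by blast
    note bounds = DS_lambda_bounds[OF DS sparse_padded_line_word[OF kj(1)]]
    have "real n / (2 * (real k)\<^sup>2) \<le> real m"
    proof -
      have "m \<ge> 1" using nk kj by (simp add: m_def div_greater_zero_iff Suc_le_eq)
      moreover have "n < k\<^sup>2 * (m + 1)"
        using kj dividend_less_times_div[of "k\<^sup>2" n] by (simp add: m_def)
      ultimately have "n \<le> k\<^sup>2 * (2 * m)"
        using mult_le_mono2[of "m + 1" "2 * m" "k\<^sup>2"] by linarith
      then have "real n \<le> (real k)\<^sup>2 * (2 * real m)"
        by (metis of_nat_le_iff of_nat_mult of_nat_numeral of_nat_power)
      then show ?thesis using kj by (simp add: field_simps)
    qed
    moreover have "real s / 8 \<le> real t"
    proof -
      have "s \<le> 8 * (s div 4)" using s4 by presburger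
      then show ?thesis unfolding t_def by linarith
    qed
    ultimately have "(real n / (2 * (real k)\<^sup>2))\<^sup>2 * (real s / 8) * real k
        \<le> (real m)\<^sup>2 * real t * real k"
      by (intro mult_mono power_mono) auto
    also have "(real n / (2 * (real k)\<^sup>2))\<^sup>2 * (real s / 8) * real k = A * (real s * (real n)\<^sup>2)"
      using kj by (simp add: A_def field_simps power2_eq_square power3_eq_cube)
    also have "(real m)\<^sup>2 * real t * real k = real (length (line_word k m t))"
      by (simp add: length_line_word)
    also have "\<dots> \<le> real (DS_lambda s n j)"
      using bounds(1) by (simp add: padded_line_word_def)
    finally have lower: "A * (real s * (real n)\<^sup>2) \<le> real (DS_lambda s n j)" .
    have "1 \<le> s * n\<^sup>2" using s(1) npos by (simp add: Suc_le_eq)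
    then have "DS_lambda s n j \<le> 2 * (s * n\<^sup>2)" using bounds(2) by linarith
    then have "real (DS_lambda s n j) \<le> 2 * (real s * (real n)\<^sup>2)"
      by (metis of_nat_le_iff of_nat_mult of_nat_numeral of_nat_power)
    with lower show ?thesis by simp
  qed
  have "\<forall>\<^sub>F n in sequentially. \<forall>s::nat. s \<ge> 1 \<and> real s \<ge> c * real n \<longrightarrow>
           A * (real s * (real n)\<^sup>2) \<le> real (DS_lambda s n j) \<and>
           real (DS_lambda s n j) \<le> 2 * (real s * (real n)\<^sup>2)"
    using main unfolding eventually_sequentially by blast
  then show ?thesis using \<open>A > 0\<close> by (intro exI[of _ A] exI[of _ 2] conjI) auto
qed

end
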